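(* Let $\mathcal H = (A, M)$ be a hypergraph, where $A$ is a finite nonempty set, $M$ is a family of subsets of $A$ with $\emptyset \in M$, and every $a \in A$ is contained in some $m \in M$. Then $p_R = \frac{1}{k^{\ge}_f(\mathcal H)}$.
   Context: For $a \in A$, write $M_a = \{m \in M : a \in m\}$. The Rawlsian justice $p_R$ of $(A,M)$ is the optimal value of the linear program: maximize $p$ subject to $\sum_{m \in M_a} x_m \ge p$ for all $a \in A$, $\sum_{m \in M} x_m = 1$, $x_m \ge 0$ for all $m \in M$, $p \in \mathbb{R}$. The fractional covering number $k^{\ge}_f(\mathcal H)$ of the hypergraph $\mathcal H = (A,M)$ (vertex set $A$, hyperedges $M$) is the optimal value of the linear program: minimize $\sum_{m \in M} w_m$ subject to $\sum_{m \in M_a} w_m \ge 1$ for all $a \in A$ and $w_m \ge 0$ for all $m \in M$. *)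

theory Defs
  imports Complex_Main
begin

definition incident :: "'a set set \<Rightarrow> 'a \<Rightarrow> 'a set set" where
  "incident M a = {m \<in> M. a \<in> m}"

(* LP variables indexed by M are total functions 'a set => real; all constraints and
   objectives below read them on M only, so the values outside M are irrelevant. *)

definition rawls_feasible :: "'a set \<Rightarrow> 'a set set \<Rightarrow> ('a set \<Rightarrow> real) \<Rightarrow> real \<Rightarrow> bool" where
  "rawls_feasible A M x p \<longleftrightarrow>
     (\<forall>a\<in>A. (\<Sum>m\<in>incident M a. x m) \<ge> p) \<and> (\<Sum>m\<in>M. x m) = 1 \<and> (\<forall>m\<in>M. x m \<ge> 0)"

(* The optimal value is the supremum (infimum) of the objective over the feasible points.
   For finite nonempty A, M a nonempty set of subsets of A, and every a in A covered by M,
   both sets of objective values are nonempty and bounded on the relevant side, so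
   Sup and Inf on the reals are the genuine supremum and infimum. *)

definition rawlsian_justice :: "'a set \<Rightarrow> 'a set set \<Rightarrow> real" where
  "rawlsian_justice A M = Sup {p. \<exists>x. rawls_feasible A M x p}"

definition fractional_cover :: "'a set \<Rightarrow> 'a set set \<Rightarrow> ('a set \<Rightarrow> real) \<Rightarrow> bool" where
  "fractional_cover A M w \<longleftrightarrow>
     (\<forall>a\<in>A. (\<Sum>m\<in>incident M a. w m) \<ge> 1) \<and> (\<forall>m\<in>M. w m \<ge> 0)"

definition fractional_covering_number :: "'a set \<Rightarrow> 'a set set \<Rightarrow> real" where
  "fractional_covering_number A M = Inf {\<Sum>m\<in>M. w m | w. fractional_cover A M w}"

end

theory Submission
  imports Defs
begin

text \<open>
  The two linear programs are the same problem under two normalisations. The covering program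
  fixes the least coverage of a vertex to be \<open>1\<close> and minimises the total weight; the Rawlsian
  program fixes the total weight to be \<open>1\<close> and maximises the least coverage. Rescaling turns a
  cover of total weight \<open>s\<close> into a lottery with guarantee \<open>1 / s\<close>, and a lottery with guarantee
  \<open>p > 0\<close> into a cover of total weight \<open>1 / p\<close>
  (\<open>rawls_feasible_of_cover\<close>, \<open>fractional_cover_of_rawls\<close>).

  Hence the positive Rawlsian objective values are exactly the reciprocals of the covering
  objective values. Every cover has total weight at least \<open>1\<close>, so the infimum is positive and
  reciprocals exchange it with the supremum. Only order properties of the supremum and the
  infimum enter, so the existence of optimal solutions is not at issue.
\<close>

lemma rawls_feasible_of_cover:
  assumes "fractional_cover A M w" and "sum w M > 0"
  shows "rawls_feasible A M (\<lambda>m. w m / sum w M) (1 / sum w M)"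
  using assms unfolding rawls_feasible_def fractional_cover_def
  by (auto simp flip: sum_divide_distrib intro!: divide_right_mono)

lemma fractional_cover_of_rawls:
  assumes "rawls_feasible A M x p" and "p > 0"
  shows "fractional_cover A M (\<lambda>m. x m / p)" and "(\<Sum>m\<in>M. x m / p) = 1 / p"
  using assms unfolding rawls_feasible_def fractional_cover_def
  by (auto simp flip: sum_divide_distrib)

text \<open>Some vertex exists, and the edges through it alone already carry weight at least \<open>1\<close>.\<close>

lemma fractional_cover_total_ge_1:
  assumes "finite M" and "A \<noteq> {}" and "fractional_cover A M w"
  shows "1 \<le> sum w M"
proof -
  obtain a where "a \<in> A" using assms(2) by blast
  then have "1 \<le> sum w (incident M a)"
    using assms(3) by (simp add: fractional_cover_def)
  also have "\<dots> \<le> sum w M"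
    using assms(1,3) by (intro sum_mono2) (auto simp: incident_def fractional_cover_def)
  finally show ?thesis .
qed

lemma fractional_cover_const_1:
  assumes "finite M" and "\<forall>a\<in>A. \<exists>m\<in>M. a \<in> m"
  shows "fractional_cover A M (\<lambda>_. 1)"
proof -
  have "1 \<le> real (card (incident M a))" if "a \<in> A" for a
  proof -
    have "finite (incident M a)" "incident M a \<noteq> {}"
      using assms that by (auto simp: incident_def)
    then show ?thesis by (simp add: Suc_le_eq card_gt_0_iff)
  qed
  then show ?thesis by (simp add: fractional_cover_def)
qed

theorem lemma2:
  fixes A :: "'a set" and M :: "'a set set"
  assumes "finite A" and "A \<noteq> {}"
    and "M \<subseteq> Pow A" and "{} \<in> M"
    and "\<forall>a\<in>A. \<exists>m\<in>M. a \<in> m"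
  shows "rawlsian_justice A M = 1 / fractional_covering_number A M"
proof -
  define R where "R = {p. \<exists>x. rawls_feasible A M x p}"
  define W where "W = {sum w M | w. fractional_cover A M w}"
  have pR: "rawlsian_justice A M = Sup R" and kf: "fractional_covering_number A M = Inf W"
    by (simp_all add: R_def W_def rawlsian_justice_def fractional_covering_number_def)
  have finM: "finite M"
    using assms(1,3) finite_subset by auto
  have W_ge: "1 \<le> s" if "s \<in> W" for s
    using that fractional_cover_total_ge_1[OF finM assms(2)] by (auto simp: W_def)
  have W_ne: "W \<noteq> {}"
    using fractional_cover_const_1[OF finM assms(5)] by (auto simp: W_def)
  have W_bdd: "bdd_below W"
    using W_ge by (rule bdd_belowI)
  have Inf_pos: "0 < Inf W"
    using cInf_greatest[OF W_ne, of 1] W_ge by simp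
  have inv_R: "1 / s \<in> R" if s: "s \<in> W" for s
  proof -
    from s obtain w where w: "fractional_cover A M w" "s = sum w M"
      by (auto simp: W_def)
    then show ?thesis
      using rawls_feasible_of_cover[OF w(1)] W_ge[OF s] by (auto simp: R_def)
  qed
  have R_le: "p \<le> 1 / Inf W" if p: "p \<in> R" for p
  proof (cases "p > 0")
    case True
    from p obtain x where "rawls_feasible A M x p"
      by (auto simp: R_def)
    from fractional_cover_of_rawls[OF this True] have "1 / p \<in> W"
      unfolding W_def by (metis (mono_tags, lifting) mem_Collect_eq)
    then have "Inf W \<le> 1 / p"
      using W_bdd by (rule cInf_lower)
    then show ?thesis
      using True Inf_pos by (simp add: field_simps)
  next
    \<comment> \<open>A guarantee that is not positive does not rescale to a cover, but it is below the
      positive bound.\<close>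
    case False
    then show ?thesis using Inf_pos by (simp add: order_trans[of p 0])
  qed
  have R_bdd: "bdd_above R"
    using R_le by (rule bdd_aboveI)
  have R_ne: "R \<noteq> {}"
    using W_ne inv_R by blast
  have inv_le: "1 / s \<le> Sup R" if "s \<in> W" for s
    using inv_R[OF that] R_bdd by (rule cSup_upper)
  have Sup_pos: "0 < Sup R"
  proof -
    obtain s where s: "s \<in> W" using W_ne by blast
    then have "0 < 1 / s" using W_ge[OF s] by simp
    then show ?thesis using inv_le[OF s] by linarith
  qed
  have "1 / Sup R \<le> Inf W"
  proof (rule cInf_greatest[OF W_ne])
    fix s assume s: "s \<in> W"
    show "1 / Sup R \<le> s"
      using inv_le[OF s] W_ge[OF s] Sup_pos by (simp add: field_simps)
  qed
  then have "1 / Inf W \<le> Sup R"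
    using Inf_pos Sup_pos by (simp add: field_simps)
  moreover have "Sup R \<le> 1 / Inf W"
    using R_ne R_le by (rule cSup_least)
  ultimately show ?thesis
    by (simp add: pR kf)
qed

end
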